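(* Let $(X,\triangleright)$ and $(Y,\blacktriangleright)$ be left shelves, let $f:(X,\triangleright)\to(Y,\blacktriangleright)$ be a homomorphism of shelves, and let $\varphi:X\to\mathrm{Aut}(X,\triangleright)$ and $\psi:Y\to\mathrm{Aut}(Y,\blacktriangleright)$ be twists. Then the map $\Phi:X\times X\to Y\times Y$ given by $$\Phi(a,b)=\left(f(a),\ \psi^{-1}_{f(a)}f\varphi_a(b)\right)\qquad(a,b\in X)$$ is a $D$-homomorphism from the solution $(X,r_\varphi)$ to the solution $(Y,r_\psi)$. Moreover, $f$ is bijective if and only if $\Phi$ is a $D$-isomorphism.
   Context: A solution $(X,r)$ is a set $X$ with a map $r:X\times X\to X\times X$ satisfying the braid identity $(r\times \mathrm{id}_X)(\mathrm{id}_X\times r)(r\times\mathrm{id}_X)=(\mathrm{id}_X\times r)(r\times\mathrm{id}_X)(\mathrm{id}_X\times r)$. A left shelf is a non-empty set $X$ with a binary operation $\triangleright$ such that $a\triangleright(b\triangleright c)=(a\triangleright b)\triangleright(a\triangleright c)$; $L_a(b)=a\triangleright b$. A shelf homomorphism $f$ satisfies $f(a\triangleright b)=f(a)\blacktriangleright f(b)$; $\mathrm{Aut}(X,\triangleright)$ is the set of bijective shelf endomorphisms. A twist of $(X,\triangleright)$ is a map $\varphi:X\to\mathrm{Aut}(X,\triangleright)$, $a\mapsto\varphi_a$, such that $\varphi_a\varphi_b=\varphi_{\varphi_a(b)}\varphi_{\varphi^{-1}_{\varphi_a(b)}L_{\varphi_a(b)}(a)}$ for all $a,b\in X$. To a twist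 $\varphi$ one associates the solution $r_\varphi(a,b)=\big(\varphi_a(b),\ \varphi^{-1}_{\varphi_a(b)}(\varphi_a(b)\triangleright a)\big)$. For solutions $(X,r)$, $(Y,s)$, a map $\Phi:X\times X\to Y\times Y$ is a $D$-homomorphism if $\Phi\,r=s\,\Phi$; it is a $D$-isomorphism if moreover it is bijective. *)

theory Defs
  imports Main "HOL-Library.FuncSet"
begin

text \<open>
  Structures live on carrier sets; maps are HOL functions of which only the restriction to the
  carrier matters, so each equation between maps is stated pointwise on the carrier.
\<close>

definition braid12 :: "('a \<times> 'a \<Rightarrow> 'a \<times> 'a) \<Rightarrow> 'a \<times> 'a \<times> 'a \<Rightarrow> 'a \<times> 'a \<times> 'a" where
  "braid12 r = (\<lambda>(a, b, c). let (u, v) = r (a, b) in (u, v, c))"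

definition braid23 :: "('a \<times> 'a \<Rightarrow> 'a \<times> 'a) \<Rightarrow> 'a \<times> 'a \<times> 'a \<Rightarrow> 'a \<times> 'a \<times> 'a" where
  "braid23 r = map_prod id r"

definition solution :: "'a set \<Rightarrow> ('a \<times> 'a \<Rightarrow> 'a \<times> 'a) \<Rightarrow> bool" where
  "solution X r \<longleftrightarrow>
     r \<in> X \<times> X \<rightarrow> X \<times> X \<and>
     (\<forall>t \<in> X \<times> X \<times> X.
        braid12 r (braid23 r (braid12 r t)) = braid23 r (braid12 r (braid23 r t)))"

definition left_shelf :: "'a set \<Rightarrow> ('a \<Rightarrow> 'a \<Rightarrow> 'a) \<Rightarrow> bool" where
  "left_shelf X t \<longleftrightarrow>
     X \<noteq> {} \<and>
     (\<forall>a\<in>X. \<forall>b\<in>X. t a b \<in> X) \<and>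
     (\<forall>a\<in>X. \<forall>b\<in>X. \<forall>c\<in>X. t a (t b c) = t (t a b) (t a c))"

definition shelf_hom ::
  "'a set \<Rightarrow> ('a \<Rightarrow> 'a \<Rightarrow> 'a) \<Rightarrow> 'b set \<Rightarrow> ('b \<Rightarrow> 'b \<Rightarrow> 'b) \<Rightarrow> ('a \<Rightarrow> 'b) \<Rightarrow> bool" where
  "shelf_hom X t Y u f \<longleftrightarrow>
     f \<in> X \<rightarrow> Y \<and> (\<forall>a\<in>X. \<forall>b\<in>X. f (t a b) = u (f a) (f b))"

definition shelf_Aut :: "'a set \<Rightarrow> ('a \<Rightarrow> 'a \<Rightarrow> 'a) \<Rightarrow> ('a \<Rightarrow> 'a) set" where
  "shelf_Aut X t = {f. shelf_hom X t X t f \<and> bij_betw f X X}"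

definition twist :: "'a set \<Rightarrow> ('a \<Rightarrow> 'a \<Rightarrow> 'a) \<Rightarrow> ('a \<Rightarrow> 'a \<Rightarrow> 'a) \<Rightarrow> bool" where
  "twist X t \<phi> \<longleftrightarrow>
     \<phi> \<in> X \<rightarrow> shelf_Aut X t \<and>
     (\<forall>a\<in>X. \<forall>b\<in>X. \<forall>c\<in>X.
        \<phi> a (\<phi> b c) = \<phi> (\<phi> a b) (\<phi> (inv_into X (\<phi> (\<phi> a b)) (t (\<phi> a b) a)) c))"

definition twist_map ::
  "'a set \<Rightarrow> ('a \<Rightarrow> 'a \<Rightarrow> 'a) \<Rightarrow> ('a \<Rightarrow> 'a \<Rightarrow> 'a) \<Rightarrow> 'a \<times> 'a \<Rightarrow> 'a \<times> 'a" where
  "twist_map X t \<phi> = (\<lambda>(a, b). (\<phi> a b, inv_into X (\<phi> (\<phi> a b)) (t (\<phi> a b) a)))"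

text \<open>D-homomorphisms are defined between solutions, so being a solution is part of the notion.\<close>

definition D_hom ::
  "'a set \<Rightarrow> ('a \<times> 'a \<Rightarrow> 'a \<times> 'a) \<Rightarrow> 'b set \<Rightarrow> ('b \<times> 'b \<Rightarrow> 'b \<times> 'b) \<Rightarrow>
   ('a \<times> 'a \<Rightarrow> 'b \<times> 'b) \<Rightarrow> bool" where
  "D_hom X r Y s \<Phi> \<longleftrightarrow>
     solution X r \<and> solution Y s \<and>
     \<Phi> \<in> X \<times> X \<rightarrow> Y \<times> Y \<and> (\<forall>p \<in> X \<times> X. \<Phi> (r p) = s (\<Phi> p))"

definition D_iso ::
  "'a set \<Rightarrow> ('a \<times> 'a \<Rightarrow> 'a \<times> 'a) \<Rightarrow> 'b set \<Rightarrow> ('b \<times> 'b \<Rightarrow> 'b \<times> 'b) \<Rightarrow>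
   ('a \<times> 'a \<Rightarrow> 'b \<times> 'b) \<Rightarrow> bool" where
  "D_iso X r Y s \<Phi> \<longleftrightarrow> D_hom X r Y s \<Phi> \<and> bij_betw \<Phi> (X \<times> X) (Y \<times> Y)"

end

theory Submission
  imports Defs
begin

text \<open>
  Every twist becomes trivial after a change of coordinates. In the coordinates
  \<open>J\<^sub>\<phi> (a, b) = (a, \<phi> a b)\<close>, a permutation of \<open>X \<times> X\<close>, the map \<open>twist_map X t \<phi>\<close> turns into
  \<open>(a, c) \<mapsto> (c, t c a)\<close>, which no longer mentions \<open>\<phi>\<close> and on which a shelf homomorphism \<open>f\<close> acts
  simply through \<open>f \<times> f\<close>. The map \<open>\<Phi>\<close> is the one that these coordinates turn into \<open>f \<times> f\<close>, that is,
  \<open>J\<^sub>\<psi> \<circ> \<Phi> = (f \<times> f) \<circ> J\<^sub>\<phi>\<close>. Hence it intertwines the two maps, and it is bijective exactly when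
  \<open>f \<times> f\<close> is, which means exactly when \<open>f\<close> is.

  By definition a \<open>D\<close>-homomorphism runs between solutions, so the braid identity for \<open>twist_map X t \<phi>\<close> is
  needed as well. It comes from the analogous coordinates
  \<open>(a, b, c) \<mapsto> (a, \<phi> a b, \<phi> a (\<phi> b c))\<close> on triples: the twist identity says that they
  straighten the action on the first two entries, and the fact that \<open>\<phi> a\<close> is an endomorphism of the
  shelf says the same for the last two. For the straightened map the braid identity is
  left self-distributivity.
\<close>

definition shelf_map :: "('a \<Rightarrow> 'a \<Rightarrow> 'a) \<Rightarrow> 'a \<times> 'a \<Rightarrow> 'a \<times> 'a" where
  "shelf_map t = (\<lambda>(a, c). (c, t c a))"

definition twist_coords :: "('a \<Rightarrow> 'a \<Rightarrow> 'a) \<Rightarrow> 'a \<times> 'a \<Rightarrow> 'a \<times> 'a" where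
  "twist_coords \<phi> = (\<lambda>(a, b). (a, \<phi> a b))"

text \<open>This is the three-strand case of what is known as the guitar map.\<close>

definition guitar :: "('a \<Rightarrow> 'a \<Rightarrow> 'a) \<Rightarrow> 'a \<times> 'a \<times> 'a \<Rightarrow> 'a \<times> 'a \<times> 'a" where
  "guitar \<phi> = (\<lambda>(a, b, c). (a, \<phi> a b, \<phi> a (\<phi> b c)))"

lemma left_shelf_closed: "left_shelf X t \<Longrightarrow> a \<in> X \<Longrightarrow> b \<in> X \<Longrightarrow> t a b \<in> X"
  by (simp add: left_shelf_def)

lemma twist_bij:
  assumes "twist X t \<phi>" "a \<in> X"
  shows "bij_betw (\<phi> a) X X"
  using assms by (auto simp: twist_def shelf_Aut_def)

lemma twist_closed:
  assumes "twist X t \<phi>" "a \<in> X" "b \<in> X"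
  shows "\<phi> a b \<in> X"
  using twist_bij[OF assms(1,2)] assms(3) by (rule bij_betw_apply)

lemma twist_hom:
  assumes "twist X t \<phi>" "a \<in> X" "b \<in> X" "c \<in> X"
  shows "\<phi> a (t b c) = t (\<phi> a b) (\<phi> a c)"
proof -
  have "shelf_hom X t X t (\<phi> a)"
    using assms(1,2) by (auto simp: twist_def shelf_Aut_def)
  then show ?thesis
    using assms(3,4) by (simp add: shelf_hom_def)
qed

lemma twist_inv_closed:
  assumes "twist X t \<phi>" "a \<in> X" "b \<in> X"
  shows "inv_into X (\<phi> a) b \<in> X"
  using twist_bij[OF assms(1,2)] assms(3) by (metis bij_betw_imp_surj_on inv_into_into)

lemma twist_inv_right:
  assumes "twist X t \<phi>" "a \<in> X" "b \<in> X"
  shows "\<phi> a (inv_into X (\<phi> a) b) = b"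
  using twist_bij[OF assms(1,2)] assms(3) by (rule bij_betw_inv_into_right)

lemma twist_map_closed:
  assumes "left_shelf X t" "twist X t \<phi>"
  shows "twist_map X t \<phi> \<in> X \<times> X \<rightarrow> X \<times> X"
  using assms by (auto simp: twist_map_def intro: twist_inv_closed twist_closed left_shelf_closed)

lemma bij_betw_twist_coords:
  assumes "twist X t \<phi>"
  shows "bij_betw (twist_coords \<phi>) (X \<times> X) (X \<times> X)"
proof (rule bij_betw_byWitness[where f' = "\<lambda>(a, c). (a, inv_into X (\<phi> a) c)"])
  show "\<forall>p\<in>X \<times> X. (\<lambda>(a, c). (a, inv_into X (\<phi> a) c)) (twist_coords \<phi> p) = p"
    by (auto simp: twist_coords_def bij_betw_inv_into_left[OF twist_bij[OF assms]])
qed (auto simp: twist_coords_def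
       intro: twist_inv_right[OF assms] twist_closed[OF assms] twist_inv_closed[OF assms])

lemma twist_coords_twist_map:
  assumes "left_shelf X t" "twist X t \<phi>" "p \<in> X \<times> X"
  shows "twist_coords \<phi> (twist_map X t \<phi> p) = shelf_map t (twist_coords \<phi> p)"
  using assms
  by (auto simp: twist_coords_def twist_map_def shelf_map_def twist_inv_right twist_closed
      left_shelf_closed)

lemma guitar_closed:
  assumes "twist X t \<phi>" "p \<in> X \<times> X \<times> X"
  shows "guitar \<phi> p \<in> X \<times> X \<times> X"
  using assms by (auto simp: guitar_def twist_closed)

lemma inj_on_guitar:
  assumes "twist X t \<phi>"
  shows "inj_on (guitar \<phi>) (X \<times> X \<times> X)"
proof (rule inj_onI)
  have cancel: "b = c" if "\<phi> a b = \<phi> a c" "a \<in> X" "b \<in> X" "c \<in> X" for a b c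
    using that bij_betw_imp_inj_on[OF twist_bij[OF assms]] by (meson inj_onD)
  fix p q
  assume "p \<in> X \<times> X \<times> X" "q \<in> X \<times> X \<times> X" and eq: "guitar \<phi> p = guitar \<phi> q"
  then obtain a b c a' b' c' where
    [simp]: "p = (a, b, c)" "q = (a', b', c')"
    and mem: "a \<in> X" "b \<in> X" "c \<in> X" "a' \<in> X" "b' \<in> X" "c' \<in> X"
    by auto
  have [simp]: "a' = a" using eq by (simp add: guitar_def)
  have [simp]: "b' = b"
    using cancel[of a b b'] eq mem by (simp add: guitar_def)
  have "\<phi> b c = \<phi> b c'"
    using cancel[of a "\<phi> b c" "\<phi> b c'"] eq mem by (simp add: guitar_def twist_closed[OF assms])
  then have "c = c'"
    using cancel mem by blast
  then show "p = q" by simp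
qed

text \<open>
  The first two coordinates are handled as for pairs. The third one, \<open>\<phi> a (\<phi> b c)\<close>, must not
  change when \<open>(a, b)\<close> is replaced by its image, and this is what the twist identity asserts.
\<close>

lemma guitar_braid12:
  assumes "left_shelf X t" "twist X t \<phi>" "p \<in> X \<times> X \<times> X"
  shows "guitar \<phi> (braid12 (twist_map X t \<phi>) p) = braid12 (shelf_map t) (guitar \<phi> p)"
proof -
  obtain a b c where [simp]: "p = (a, b, c)" and mem: "a \<in> X" "b \<in> X" "c \<in> X"
    using assms(3) by auto
  have "\<phi> a (\<phi> b c) = \<phi> (\<phi> a b) (\<phi> (inv_into X (\<phi> (\<phi> a b)) (t (\<phi> a b) a)) c)"
    using assms(2) mem by (simp add: twist_def)
  moreover have "\<phi> (\<phi> a b) (inv_into X (\<phi> (\<phi> a b)) (t (\<phi> a b) a)) = t (\<phi> a b) a"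
    using assms mem by (simp add: twist_inv_right twist_closed left_shelf_closed)
  ultimately show ?thesis
    by (simp add: guitar_def braid12_def twist_map_def shelf_map_def)
qed

text \<open>
  The change happens behind the outer map \<open>\<phi> a\<close>, which passes through the operation because it is
  an endomorphism.
\<close>

lemma guitar_braid23:
  assumes "left_shelf X t" "twist X t \<phi>" "p \<in> X \<times> X \<times> X"
  shows "guitar \<phi> (braid23 (twist_map X t \<phi>) p) = braid23 (shelf_map t) (guitar \<phi> p)"
proof -
  obtain a b c where [simp]: "p = (a, b, c)" and mem: "a \<in> X" "b \<in> X" "c \<in> X"
    using assms(3) by auto
  have "\<phi> (\<phi> b c) (inv_into X (\<phi> (\<phi> b c)) (t (\<phi> b c) b)) = t (\<phi> b c) b"
    using assms mem by (simp add: twist_inv_right twist_closed left_shelf_closed)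
  moreover have "\<phi> a (t (\<phi> b c) b) = t (\<phi> a (\<phi> b c)) (\<phi> a b)"
    using assms(2) mem by (simp add: twist_hom twist_closed)
  ultimately show ?thesis
    by (simp add: guitar_def braid23_def twist_map_def shelf_map_def)
qed

lemma shelf_map_braid:
  assumes "left_shelf X t" "p \<in> X \<times> X \<times> X"
  shows "braid12 (shelf_map t) (braid23 (shelf_map t) (braid12 (shelf_map t) p))
       = braid23 (shelf_map t) (braid12 (shelf_map t) (braid23 (shelf_map t) p))"
  using assms by (auto simp: braid12_def braid23_def shelf_map_def left_shelf_def)

lemma braid12_closed: "r \<in> X \<times> X \<rightarrow> X \<times> X \<Longrightarrow> p \<in> X \<times> X \<times> X \<Longrightarrow> braid12 r p \<in> X \<times> X \<times> X"
  by (cases p) (force simp: braid12_def dest: funcset_mem split: prod.splits)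

lemma braid23_closed: "r \<in> X \<times> X \<rightarrow> X \<times> X \<Longrightarrow> p \<in> X \<times> X \<times> X \<Longrightarrow> braid23 r p \<in> X \<times> X \<times> X"
  by (cases p) (auto simp: braid23_def simp del: mem_Times_iff)

text \<open>
  The guitar map carries both sides of the braid identity to the corresponding sides for
  \<open>shelf_map t\<close>, where they agree; being injective, it reflects this equality.
\<close>

lemma solution_twist_map:
  assumes "left_shelf X t" "twist X t \<phi>"
  shows "solution X (twist_map X t \<phi>)"
  unfolding solution_def
proof (intro conjI ballI)
  let ?r = "twist_map X t \<phi>"
  show closed: "?r \<in> X \<times> X \<rightarrow> X \<times> X"
    using assms by (rule twist_map_closed)
  note [simp] = braid12_closed[OF closed] braid23_closed[OF closed]
  fix p assume p: "p \<in> X \<times> X \<times> X"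
  have "guitar \<phi> (braid12 ?r (braid23 ?r (braid12 ?r p)))
      = guitar \<phi> (braid23 ?r (braid12 ?r (braid23 ?r p)))"
    using p shelf_map_braid[OF assms(1) guitar_closed[OF assms(2) p]]
    by (simp add: guitar_braid12[OF assms] guitar_braid23[OF assms])
  with inj_on_guitar[OF assms(2)]
  show "braid12 ?r (braid23 ?r (braid12 ?r p)) = braid23 ?r (braid12 ?r (braid23 ?r p))"
    by (rule inj_onD) (use p in simp_all)
qed

lemma shelf_map_hom:
  assumes "shelf_hom X t Y u f" "p \<in> X \<times> X"
  shows "map_prod f f (shelf_map t p) = shelf_map u (map_prod f f p)"
  using assms by (auto simp: shelf_map_def shelf_hom_def)

lemma bij_betw_map_prod_diag:
  "bij_betw (map_prod f f) (X \<times> X) (Y \<times> Y) \<longleftrightarrow> bij_betw f X Y"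
proof
  assume bij: "bij_betw (map_prod f f) (X \<times> X) (Y \<times> Y)"
  have "inj_on f X"
  proof (rule inj_onI)
    fix a b assume "a \<in> X" "b \<in> X" "f a = f b"
    then show "a = b"
      using inj_onD[OF bij_betw_imp_inj_on[OF bij], of "(a, a)" "(b, b)"] by simp
  qed
  moreover have "f ` X = Y"
  proof -
    have "(f ` X) \<times> (f ` X) = Y \<times> Y"
      using bij_betw_imp_surj_on[OF bij] by (simp add: map_prod_surj_on)
    then show ?thesis by blast
  qed
  ultimately show "bij_betw f X Y" by (simp add: bij_betw_def)
next
  assume "bij_betw f X Y"
  then show "bij_betw (map_prod f f) (X \<times> X) (Y \<times> Y)"
    by (simp add: bij_betw_def map_prod_inj_on map_prod_surj_on)
qed

theorem lemma2p25:
  fixes X :: "'a set" and Y :: "'b set"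
    and t :: "'a \<Rightarrow> 'a \<Rightarrow> 'a" and u :: "'b \<Rightarrow> 'b \<Rightarrow> 'b"
    and f :: "'a \<Rightarrow> 'b"
    and \<phi> :: "'a \<Rightarrow> 'a \<Rightarrow> 'a" and \<psi> :: "'b \<Rightarrow> 'b \<Rightarrow> 'b"
    and \<Phi> :: "'a \<times> 'a \<Rightarrow> 'b \<times> 'b"
  assumes "left_shelf X t" and "left_shelf Y u"
    and "shelf_hom X t Y u f"
    and "twist X t \<phi>" and "twist Y u \<psi>"
    and "\<And>a b. a \<in> X \<Longrightarrow> b \<in> X \<Longrightarrow>
           \<Phi> (a, b) = (f a, inv_into Y (\<psi> (f a)) (f (\<phi> a b)))"
  shows "D_hom X (twist_map X t \<phi>) Y (twist_map Y u \<psi>) \<Phi> \<and>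
         (bij_betw f X Y \<longleftrightarrow> D_iso X (twist_map X t \<phi>) Y (twist_map Y u \<psi>) \<Phi>)"
proof -
  note X = \<open>left_shelf X t\<close> and Y = \<open>left_shelf Y u\<close> and f = \<open>shelf_hom X t Y u f\<close>
    and \<phi> = \<open>twist X t \<phi>\<close> and \<psi> = \<open>twist Y u \<psi>\<close> and \<Phi> = assms(6)
  let ?r = "twist_map X t \<phi>" and ?s = "twist_map Y u \<psi>"
  have f_closed: "f a \<in> Y" if "a \<in> X" for a
    using f that by (auto simp: shelf_hom_def)
  have \<Phi>_closed: "\<Phi> \<in> X \<times> X \<rightarrow> Y \<times> Y"
    by (auto simp: \<Phi> twist_inv_closed[OF \<psi>] f_closed twist_closed[OF \<phi>])
  have \<Phi>_coords: "twist_coords \<psi> (\<Phi> p) = map_prod f f (twist_coords \<phi> p)" if "p \<in> X \<times> X" for p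
    using that
    by (auto simp: \<Phi> twist_coords_def twist_inv_right[OF \<psi>] f_closed twist_closed[OF \<phi>])
  note r_closed = twist_map_closed[OF X \<phi>] and s_closed = twist_map_closed[OF Y \<psi>]
  note coords_\<phi> = bij_betw_twist_coords[OF \<phi>] and coords_\<psi> = bij_betw_twist_coords[OF \<psi>]

  have intertwine: "\<Phi> (?r p) = ?s (\<Phi> p)" if p: "p \<in> X \<times> X" for p
  proof -
    have rp: "?r p \<in> X \<times> X" and \<Phi>p: "\<Phi> p \<in> Y \<times> Y"
      using p r_closed \<Phi>_closed by blast+
    have "twist_coords \<psi> (\<Phi> (?r p)) = map_prod f f (twist_coords \<phi> (?r p))"
      using rp by (rule \<Phi>_coords)
    also have "\<dots> = map_prod f f (shelf_map t (twist_coords \<phi> p))"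
      using p by (simp only: twist_coords_twist_map[OF X \<phi>])
    also have "\<dots> = shelf_map u (map_prod f f (twist_coords \<phi> p))"
      using f bij_betw_apply[OF coords_\<phi> p] by (rule shelf_map_hom)
    also have "\<dots> = shelf_map u (twist_coords \<psi> (\<Phi> p))"
      using p by (simp only: \<Phi>_coords)
    also have "\<dots> = twist_coords \<psi> (?s (\<Phi> p))"
      using \<Phi>p by (simp only: twist_coords_twist_map[OF Y \<psi>])
    finally show ?thesis
      by (rule inj_onD[OF bij_betw_imp_inj_on[OF coords_\<psi>]])
        (fact funcset_mem[OF \<Phi>_closed rp] funcset_mem[OF s_closed \<Phi>p])+
  qed
  have hom: "D_hom X ?r Y ?s \<Phi>"
    unfolding D_hom_def
    using solution_twist_map[OF X \<phi>] solution_twist_map[OF Y \<psi>] \<Phi>_closed intertwine by blast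

  have "bij_betw \<Phi> (X \<times> X) (Y \<times> Y) \<longleftrightarrow> bij_betw (twist_coords \<psi> \<circ> \<Phi>) (X \<times> X) (Y \<times> Y)"
    using coords_\<psi> funcset_image[OF \<Phi>_closed] by (rule bij_betw_comp_iff2)
  also have "\<dots> \<longleftrightarrow> bij_betw (map_prod f f \<circ> twist_coords \<phi>) (X \<times> X) (Y \<times> Y)"
    by (rule bij_betw_cong) (simp only: comp_apply \<Phi>_coords)
  also have "\<dots> \<longleftrightarrow> bij_betw (map_prod f f) (X \<times> X) (Y \<times> Y)"
    using bij_betw_comp_iff[OF coords_\<phi>] by blast
  also have "\<dots> \<longleftrightarrow> bij_betw f X Y"
    by (rule bij_betw_map_prod_diag)
  finally show ?thesis
    using hom by (simp add: D_iso_def)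
qed

end
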